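(* Let $n\ge 3$, $0<m<\frac{n-2}{n}$, $\eta>0$, $\rho>0$, and let $\alpha,\beta\in\mathbb{R}$ satisfy $\alpha=\frac{2\beta+\rho}{1-m}$ and $\beta>\frac{m\rho}{n-2-mn}$. Suppose $v$ is a solution of $$\frac{n-1}{m}\left((v^m)''+\frac{n-1}{r}(v^m)'\right)+\alpha v+\beta r v'=0,\quad v>0,\quad \text{in }(0,\infty),$$ with $v(0)=\eta$, $v'(0)=0$. Then $$\lim_{r\to\infty} r^2 v(r)^{1-m}=\frac{2(n-1)(n(1-m)-2)}{(1-m)(\alpha(1-m)-2\beta)}.$$
   Context: This ODE is the equation satisfied by radially symmetric solutions $v(|x|)$ of $\frac{n-1}{m}\Delta v^m+\alpha v+\beta x\cdot\nabla v=0$, $v>0$, in $\mathbb{R}^n$. *)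

theory Defs
  imports "HOL-Analysis.Analysis"
begin

end

theory Submission
  imports Defs
begin

text \<open>
  In the logarithmic variable \<open>s = ln r\<close>, the quantities \<open>q = r\<^sup>2 v\<^bsup>1-m\<^esup>\<close> and
  \<open>t = \<alpha>/\<beta> + r v'/v\<close> satisfy the autonomous system
  \<open>t' = D + B t - m t\<^sup>2 - c q t\<close>, \<open>q' = k q (t - \<tau>)\<close>, where the lower bound on \<open>\<beta>\<close>
  says exactly that \<open>D > 0\<close>. Hence \<open>t\<close> stays positive once it is positive, which it is near
  \<open>r = 0\<close>, and with \<open>Q\<close> the equilibrium value of \<open>q\<close> the function
  \<open>c (q - Q ln q) + k (t - \<tau> ln t)\<close> has derivative \<open>- k (t - \<tau>)\<^sup>2 (m + D/(t \<tau>))\<close>.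
  It bounds the orbit and forces \<open>t \<rightarrow> \<tau>\<close>; then \<open>t' \<rightarrow> 0\<close>, and the first equation gives \<open>q \<rightarrow> Q\<close>.
\<close>

section \<open>Barbalat-type lemmas\<close>

text \<open>Since \<open>g\<close> is Lipschitz with constant \<open>C\<close>, a value
  \<open>g s \<ge> \<epsilon>\<close> keeps \<open>g\<close> above \<open>\<epsilon> / 2\<close> on
  a step of fixed length, so \<open>f\<close> drops by a fixed amount there; convergence of
  \<open>f\<close> rules this out for large \<open>s\<close>.\<close>

lemma barbalat_upper:
  fixes f f' g g' :: "real \<Rightarrow> real"
  assumes f: "\<And>s. s \<ge> a \<Longrightarrow> (f has_real_derivative f' s) (at s)"
    and le: "\<And>s. s \<ge> a \<Longrightarrow> f' s \<le> - g s"
    and g: "\<And>s. s \<ge> a \<Longrightarrow> (g has_real_derivative g' s) (at s)"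
    and bound: "\<And>s. s \<ge> a \<Longrightarrow> \<bar>g' s\<bar> \<le> C"
    and lim: "(f \<longlongrightarrow> L) at_top" and "\<epsilon> > 0"
  shows "eventually (\<lambda>s. g s < \<epsilon>) at_top"
proof -
  have C: "C \<ge> 0" using bound[of a] by simp
  \<comment> \<open>The step length is chosen so that \<open>g\<close> drifts by less than
    \<open>\<epsilon> / 2\<close> over it; \<open>C + 1\<close> covers the case
    \<open>C = 0\<close>.\<close>
  define h where "h = \<epsilon> / (2 * (C + 1))"
  have h: "h > 0" and Ch: "C * h < \<epsilon> / 2"
    using C \<open>\<epsilon> > 0\<close> by (auto simp: h_def field_simps)
  have step: "h * g s \<le> f s - f (s + h) + h * (C * h)" if s: "s \<ge> a" for s
  proof -
    obtain z where z: "s < z" "z < s + h" "f (s + h) - f s = (s + h - s) * f' z"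
      using MVT2[of s "s + h" f f'] h f s by auto
    obtain y where y: "s < y" "y < z" "g z - g s = (z - s) * g' y"
      using MVT2[of s z g g'] z g s by auto
    have "\<bar>(z - s) * g' y\<bar> \<le> h * C"
      unfolding abs_mult using bound[of y] y z s C by (intro mult_mono) auto
    then have "g z \<ge> g s - C * h" using y by (simp add: mult.commute)
    moreover have "f' z \<le> - g z" using le z s by simp
    ultimately have "h * f' z \<le> h * (C * h - g s)"
      using h by (intro mult_left_mono) auto
    then show ?thesis using z by (simp add: algebra_simps)
  qed
  have "filterlim (\<lambda>s. s + h) at_top at_top"
    by (rule filterlim_at_top_mono[OF filterlim_ident]) (use h in auto)
  then have "((\<lambda>s. f s - f (s + h)) \<longlongrightarrow> L - L) at_top"
    by (intro tendsto_diff lim filterlim_compose[OF lim])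
  then have "eventually (\<lambda>s. f s - f (s + h) < h * (\<epsilon> / 2)) at_top"
    using h \<open>\<epsilon> > 0\<close> by (intro order_tendstoD(2)[where y = "L - L"]) auto
  then show ?thesis
    using eventually_ge_at_top[of a]
  proof eventually_elim
    case (elim s)
    have "h * (C * h) < h * (\<epsilon> / 2)" using h Ch by simp
    then have "h * g s < h * \<epsilon>" using step[of s] elim by argo
    then show ?case using h by simp
  qed
qed

text \<open>The one-sided lemma applied to \<open>- f\<close> and to \<open>f\<close> bounds
  \<open>f'\<close> from above and from below.\<close>

lemma barbalat:
  fixes f f' f'' :: "real \<Rightarrow> real"
  assumes f: "\<And>s. s \<ge> a \<Longrightarrow> (f has_real_derivative f' s) (at s)"
    and f': "\<And>s. s \<ge> a \<Longrightarrow> (f' has_real_derivative f'' s) (at s)"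
    and bound: "\<And>s. s \<ge> a \<Longrightarrow> \<bar>f'' s\<bar> \<le> C"
    and lim: "(f \<longlongrightarrow> L) at_top"
  shows "(f' \<longlongrightarrow> 0) at_top"
proof (rule tendstoI)
  fix \<epsilon> :: real assume "\<epsilon> > 0"
  have "eventually (\<lambda>s. f' s < \<epsilon>) at_top"
    by (rule barbalat_upper[where f = "\<lambda>s. - f s" and f' = "\<lambda>s. - f' s" and L = "- L"])
      (use assms \<open>\<epsilon> > 0\<close> in \<open>auto intro!: derivative_eq_intros tendsto_intros\<close>)
  moreover have "eventually (\<lambda>s. - f' s < \<epsilon>) at_top"
    by (rule barbalat_upper[where f = f and f' = f' and g' = "\<lambda>s. - f'' s"])
      (use assms \<open>\<epsilon> > 0\<close> in \<open>auto intro!: derivative_eq_intros\<close>)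
  ultimately show "eventually (\<lambda>s. dist (f' s) 0 < \<epsilon>) at_top"
    by eventually_elim (auto simp: dist_real_def)
qed

section \<open>Logarithmic bounds, invariance of positivity, monotone limits\<close>

text \<open>The tangent to \<open>ln\<close> at \<open>X\<close> lies above the graph. This bounds
  the Lyapunov function from below.\<close>

lemma minus_mult_ln_ge:
  fixes x X :: real
  assumes "x > 0" "X > 0"
  shows "X - X * ln X \<le> x - X * ln x"
proof -
  have "ln (x / X) \<le> x / X - 1" using assms by (intro ln_le_minus_one) auto
  then have "X * (ln x - ln X) \<le> X * (x / X - 1)"
    using assms by (intro mult_left_mono) (auto simp: ln_div)
  then show ?thesis using assms by (simp add: algebra_simps)
qed

text \<open>The tangent to \<open>ln\<close> at \<open>2 * X\<close> instead of \<open>X\<close> has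
  slope \<open>1 / (2 * X)\<close>, so \<open>X * ln x\<close> absorbs only half of \<open>x\<close>
  and the other half stays bounded.\<close>

lemma le_of_minus_mult_ln_le:
  fixes x X C :: real
  assumes "x > 0" "X > 0" "x - X * ln x \<le> C"
  shows "x \<le> 2 * (C + X * ln (2 * X))"
proof -
  have "ln (x / (2 * X)) \<le> x / (2 * X) - 1" using assms by (intro ln_le_minus_one) auto
  then have "X * (ln x - ln (2 * X)) \<le> X * (x / (2 * X) - 1)"
    using assms by (intro mult_left_mono) (auto simp: ln_div)
  then show ?thesis using assms by (simp add: algebra_simps)
qed

text \<open>At a first zero the positive derivative would make \<open>f\<close> negative just before
  it, and the intermediate value theorem would then give an earlier zero.\<close>

lemma positive_if_derivative_positive_at_zeros:
  fixes f f' :: "real \<Rightarrow> real"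
  assumes f: "\<And>s. s \<ge> a \<Longrightarrow> (f has_real_derivative f' s) (at s)"
    and zero: "\<And>s. s \<ge> a \<Longrightarrow> f s = 0 \<Longrightarrow> f' s > 0"
    and "f a > 0" "s \<ge> a"
  shows "f s > 0"
proof (rule ccontr)
  assume "\<not> f s > 0"
  have cont: "continuous_on {a..s} f"
    using f by (meson DERIV_isCont atLeastAtMost_iff continuous_at_imp_continuous_on)
  define Z where "Z = {x \<in> {a..s}. f x = 0}"
  have "compact Z"
    unfolding Z_def using continuous_closed_preimage_constant[OF cont, of 0]
    by (auto simp: compact_eq_bounded_closed intro: bounded_subset[of "{a..s}"])
  moreover have "Z \<noteq> {}"
    using IVT2'[of f s 0 a, OF _ _ _ cont] assms \<open>\<not> f s > 0\<close> by (auto simp: Z_def)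
  ultimately obtain z where z: "z \<in> Z" "\<And>y. y \<in> Z \<Longrightarrow> z \<le> y"
    using compact_attains_inf[of Z] by metis
  have za: "z > a" "z \<le> s" "f z = 0"
    using z(1) \<open>f a > 0\<close> by (auto simp: Z_def order_le_less)
  obtain d where d: "d > 0" "\<And>h. h > 0 \<Longrightarrow> h < d \<Longrightarrow> f (z - h) < f z"
    using DERIV_pos_inc_left[OF f zero] za by (metis less_imp_le)
  define h where "h = min (d / 2) ((z - a) / 2)"
  have h: "h > 0" "h < d" "a \<le> z - h" using d za by (auto simp: h_def min_def field_simps)
  have "f (z - h) \<le> 0" using d(2)[OF h(1,2)] za by simp
  moreover have "continuous_on {a..z - h} f"
    by (rule continuous_on_subset[OF cont]) (use za h in auto)
  ultimately obtain y where "a \<le> y" "y \<le> z - h" "f y = 0"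
    using IVT2'[of f "z - h" 0 a] \<open>f a > 0\<close> h by auto
  then have "y \<in> Z" using za h by (auto simp: Z_def)
  then show False using z(2)[of y] \<open>y \<le> z - h\<close> h by simp
qed

lemma decreasing_bounded_below_tendsto:
  fixes f f' :: "real \<Rightarrow> real"
  assumes f: "\<And>s. s \<ge> a \<Longrightarrow> (f has_real_derivative f' s) (at s)"
    and neg: "\<And>s. s \<ge> a \<Longrightarrow> f' s \<le> 0"
    and bound: "\<And>s. s \<ge> a \<Longrightarrow> b \<le> f s"
  obtains L where "(f \<longlongrightarrow> L) at_top" "\<And>s. s \<ge> a \<Longrightarrow> f s \<le> f a"
proof -
  have anti: "f y \<le> f x" if "a \<le> x" "x \<le> y" for x y
    using that by (intro DERIV_nonpos_imp_nonincreasing[of x y f]) (auto intro!: exI f neg)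
  have bdd: "bdd_below (f ` {a..})" using bound by (auto intro!: bdd_belowI[of _ b])
  have "(f \<longlongrightarrow> Inf (f ` {a..})) at_top"
  proof (rule order_tendstoI)
    fix y assume "y < Inf (f ` {a..})"
    then have "y < f s" if "s \<ge> a" for s
      using cInf_lower[OF _ bdd, of "f s"] that by auto
    then show "eventually (\<lambda>s. y < f s) at_top"
      by (intro eventually_at_top_linorderI[of a]) auto
  next
    fix y assume "Inf (f ` {a..}) < y"
    then obtain x where "x \<ge> a" "f x < y"
      using cInf_lessD[of "f ` {a..}" y] by auto
    then show "eventually (\<lambda>s. f s < y) at_top"
      using anti by (intro eventually_at_top_linorderI[of x]) (meson order_le_less_trans)
  qed
  then show thesis using anti that by blast
qed

section \<open>Convergence of the planar system\<close>

text \<open>By \<open>equilibrium\<close>, \<open>(\<tau>, Q)\<close> is a rest point. The Lyapunov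
  function dissipates only through \<open>t\<close>, so the limit of \<open>q\<close> has to be
  recovered from the equation for \<open>t\<close>.\<close>

lemma planar_system_tendsto:
  fixes t q :: "real \<Rightarrow> real" and B D Q c k m \<tau> :: real
  assumes t: "\<And>s. s \<ge> a \<Longrightarrow>
        (t has_real_derivative D + B * t s - m * (t s)\<^sup>2 - c * q s * t s) (at s)"
    and q: "\<And>s. s \<ge> a \<Longrightarrow> (q has_real_derivative k * q s * (t s - \<tau>)) (at s)"
    and q_pos: "\<And>s. s \<ge> a \<Longrightarrow> q s > 0" and "t a > 0"
    and pos: "D > 0" "m > 0" "c > 0" "k > 0" "\<tau> > 0" "Q > 0"
    and equilibrium: "D + B * \<tau> - m * \<tau>\<^sup>2 = c * Q * \<tau>"
  shows "(q \<longlongrightarrow> Q) at_top"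
proof -
  define t' where "t' s = D + B * t s - m * (t s)\<^sup>2 - c * q s * t s" for s
  note t = t[folded t'_def]
  have t_pos: "t s > 0" if "s \<ge> a" for s
    by (rule positive_if_derivative_positive_at_zeros[of a t t'])
      (use t \<open>t a > 0\<close> pos that in \<open>auto simp: t'_def\<close>)
  define E where "E s = c * (q s - Q * ln (q s)) + k * (t s - \<tau> * ln (t s))" for s
  define E' where "E' s = - (k * (t s - \<tau>)\<^sup>2 * (m + D / (t s * \<tau>)))" for s
  have E: "(E has_real_derivative E' s) (at s)" if s: "s \<ge> a" for s
  proof -
    have "(E has_real_derivative c * (k * q s * (t s - \<tau>) - Q * (k * q s * (t s - \<tau>) / q s))
        + k * (t' s - \<tau> * (t' s / t s))) (at s)"
      unfolding E_def using q[OF s] t[OF s] q_pos[OF s] t_pos[OF s]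
      by (auto intro!: derivative_eq_intros simp: mult.commute)
    also have "c * (k * q s * (t s - \<tau>) - Q * (k * q s * (t s - \<tau>) / q s))
        + k * (t' s - \<tau> * (t' s / t s)) = E' s"
    proof -
      \<comment> \<open>Eliminating \<open>B\<close> turns \<open>t' / t\<close> into
        \<open>D * (1/t - 1/\<tau>) - m * (t - \<tau>) - c * (q - Q)\<close>; the weights
        \<open>c\<close> and \<open>k\<close> in \<open>E\<close> make the last term cancel the
        contribution of \<open>q\<close>.\<close>
      have B: "B = (c * Q * \<tau> - D + m * \<tau>\<^sup>2) / \<tau>"
        using equilibrium pos by (simp add: field_simps)
      show ?thesis
        using q_pos[OF s] t_pos[OF s] pos unfolding E'_def t'_def B
        by (simp add: field_simps power2_eq_square)
    qed
    finally show ?thesis .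
  qed
  have E'_le: "E' s \<le> - (k * m * (t s - \<tau>)\<^sup>2)" if "s \<ge> a" for s
    unfolding E'_def using t_pos[OF that] pos by (simp add: algebra_simps)
  have q_ge: "Q - Q * ln Q \<le> q s - Q * ln (q s)"
    and t_ge: "\<tau> - \<tau> * ln \<tau> \<le> t s - \<tau> * ln (t s)" if "s \<ge> a" for s
    using minus_mult_ln_ge t_pos[OF that] q_pos[OF that] pos by auto
  have E_ge: "c * (Q - Q * ln Q) + k * (\<tau> - \<tau> * ln \<tau>) \<le> E s" if "s \<ge> a" for s
    unfolding E_def using q_ge[OF that] t_ge[OF that] pos by (intro add_mono mult_left_mono) auto
  have E'_nonpos: "E' s \<le> 0" if "s \<ge> a" for s
    using E'_le[OF that] pos by (smt (verit) mult_nonneg_nonneg zero_le_power2)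
  obtain L where L: "(E \<longlongrightarrow> L) at_top" and E_le: "\<And>s. s \<ge> a \<Longrightarrow> E s \<le> E a"
    using decreasing_bounded_below_tendsto[OF E E'_nonpos E_ge] by blast

  \<comment> \<open>Replacing one summand of \<open>E\<close> by its minimum bounds the other from
    above.\<close>
  have "\<exists>M. \<forall>s\<ge>a. q s \<le> M"
  proof (intro exI allI impI)
    fix s assume s: "s \<ge> a"
    have "c * (q s - Q * ln (q s)) + k * (\<tau> - \<tau> * ln \<tau>) \<le> E a"
      using E_le[OF s] mult_left_mono[OF t_ge[OF s], of k] pos unfolding E_def by linarith
    then have "q s - Q * ln (q s) \<le> (E a - k * (\<tau> - \<tau> * ln \<tau>)) / c"
      using pos by (simp add: field_simps)
    from le_of_minus_mult_ln_le[OF q_pos[OF s] \<open>Q > 0\<close> this]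
    show "q s \<le> 2 * ((E a - k * (\<tau> - \<tau> * ln \<tau>)) / c + Q * ln (2 * Q))" .
  qed
  then obtain Mq where Mq: "\<And>s. s \<ge> a \<Longrightarrow> q s \<le> Mq" by blast
  have "\<exists>M. \<forall>s\<ge>a. t s \<le> M"
  proof (intro exI allI impI)
    fix s assume s: "s \<ge> a"
    have "c * (Q - Q * ln Q) + k * (t s - \<tau> * ln (t s)) \<le> E a"
      using E_le[OF s] mult_left_mono[OF q_ge[OF s], of c] pos unfolding E_def by linarith
    then have "t s - \<tau> * ln (t s) \<le> (E a - c * (Q - Q * ln Q)) / k"
      using pos by (simp add: field_simps)
    from le_of_minus_mult_ln_le[OF t_pos[OF s] \<open>\<tau> > 0\<close> this]
    show "t s \<le> 2 * ((E a - c * (Q - Q * ln Q)) / k + \<tau> * ln (2 * \<tau>))" .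
  qed
  then obtain Mt where Mt: "\<And>s. s \<ge> a \<Longrightarrow> t s \<le> Mt" by blast
  \<comment> \<open>The orbit stays in a compact rectangle, so every continuous function of
    \<open>(t, q)\<close> is bounded along it; this supplies the derivative bounds for both Barbalat
    arguments.\<close>
  have "compact ({0..Mt} \<times> {0..Mq})" by (intro compact_Times) auto
  then have bounded: "\<exists>C. \<forall>s\<ge>a. \<bar>F (t s, q s)\<bar> \<le> C"
    if "continuous_on UNIV F" for F :: "real \<times> real \<Rightarrow> real"
  proof -
    have "bounded (F ` ({0..Mt} \<times> {0..Mq}))"
      using \<open>compact _\<close> that
      by (intro compact_imp_bounded compact_continuous_image) (auto intro: continuous_on_subset)
    then obtain C where "\<And>x y. x \<in> {0..Mt} \<Longrightarrow> y \<in> {0..Mq} \<Longrightarrow> \<bar>F (x, y)\<bar> \<le> C"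
      unfolding bounded_iff by (metis SigmaI imageI real_norm_def)
    then show ?thesis
      using Mt Mq t_pos q_pos by (intro exI[of _ C]) (auto simp: less_imp_le)
  qed

  \<comment> \<open>\<open>G\<close> is the part of the dissipation \<open>- E'\<close> left after
    dropping the nonnegative term with \<open>D / (t s * \<tau>)\<close>.\<close>
  define G where "G s = k * m * (t s - \<tau>)\<^sup>2" for s
  define G' where "G' s = k * m * (2 * (t s - \<tau>) * t' s)" for s
  have "continuous_on UNIV
      (\<lambda>(x, y). k * m * (2 * (x - \<tau>) * (D + B * x - m * x\<^sup>2 - c * y * x)))"
    by (auto simp: split_beta intro!: continuous_intros)
  from bounded[OF this] have "\<exists>C. \<forall>s\<ge>a. \<bar>G' s\<bar> \<le> C"
    by (simp add: G'_def t'_def)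
  then obtain CG where CG: "\<And>s. s \<ge> a \<Longrightarrow> \<bar>G' s\<bar> \<le> CG" by blast
  have G: "(G has_real_derivative G' s) (at s)" if "s \<ge> a" for s
    unfolding G_def G'_def using t[OF that] by (auto intro!: derivative_eq_intros)
  have "(G \<longlongrightarrow> 0) at_top"
  proof (rule tendstoI)
    fix \<epsilon> :: real assume "\<epsilon> > 0"
    have "eventually (\<lambda>s. G s < \<epsilon>) at_top"
      by (rule barbalat_upper[OF E _ G CG L \<open>\<epsilon> > 0\<close>]) (use E'_le in \<open>auto simp: G_def\<close>)
    then show "eventually (\<lambda>s. dist (G s) 0 < \<epsilon>) at_top"
      using pos by (simp add: G_def)
  qed
  then have "((\<lambda>s. sqrt (G s / (k * m))) \<longlongrightarrow> sqrt (0 / (k * m))) at_top"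
    by (intro tendsto_intros) (use pos in auto)
  then have "((\<lambda>s. t s - \<tau>) \<longlongrightarrow> 0) at_top"
    using pos by (simp add: G_def tendsto_rabs_zero_iff)
  then have t_lim: "(t \<longlongrightarrow> \<tau>) at_top" by (simp add: LIM_zero_iff)

  define t'' where "t'' s = (B - 2 * m * t s - c * q s) * t' s - c * t s * (k * q s * (t s - \<tau>))" for s
  have t': "(t' has_real_derivative t'' s) (at s)" if "s \<ge> a" for s
    unfolding t'_def t''_def using t[OF that, unfolded t'_def] q[OF that]
    by (auto intro!: derivative_eq_intros simp: algebra_simps)
  have "continuous_on UNIV
      (\<lambda>(x, y). (B - 2 * m * x - c * y) * (D + B * x - m * x\<^sup>2 - c * y * x)
        - c * x * (k * y * (x - \<tau>)))"
    by (auto simp: split_beta intro!: continuous_intros)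
  from bounded[OF this] have "\<exists>C. \<forall>s\<ge>a. \<bar>t'' s\<bar> \<le> C"
    by (simp add: t''_def t'_def)
  then obtain Ct where Ct: "\<And>s. s \<ge> a \<Longrightarrow> \<bar>t'' s\<bar> \<le> Ct" by blast
  have t'_lim: "(t' \<longlongrightarrow> 0) at_top"
    by (rule barbalat[OF t t' Ct t_lim])
  \<comment> \<open>The equation for \<open>t\<close> is solved for \<open>q\<close>; the division
    survives the limit because \<open>\<tau> > 0\<close>.\<close>
  have "((\<lambda>s. (D + B * t s - m * (t s)\<^sup>2 - t' s) / (c * t s)) \<longlongrightarrow>
      (D + B * \<tau> - m * \<tau>\<^sup>2 - 0) / (c * \<tau>)) at_top"
    by (intro tendsto_intros t_lim t'_lim) (use pos in auto)
  moreover have "(D + B * \<tau> - m * \<tau>\<^sup>2 - 0) / (c * \<tau>) = Q"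
    using equilibrium pos by (simp add: field_simps)
  moreover have "eventually (\<lambda>s. (D + B * t s - m * (t s)\<^sup>2 - t' s) / (c * t s) = q s) at_top"
    by (rule eventually_at_top_linorderI[of a])
      (use t_pos pos in \<open>force simp: t'_def field_simps\<close>)
  ultimately show ?thesis by (simp add: tendsto_cong)
qed

section \<open>Reduction of the radial equation to the planar system\<close>

theorem theorem1p1:
  fixes n :: nat and m \<eta> \<rho> \<alpha> \<beta> :: real
    and v v' w w' :: "real \<Rightarrow> real"
  assumes n: "n \<ge> 3"
    and m_pos: "0 < m" and m_bound: "m < (real n - 2) / real n"
    and eta: "\<eta> > 0" and rho: "\<rho> > 0"
    and alpha: "\<alpha> = (2 * \<beta> + \<rho>) / (1 - m)"
    and beta: "\<beta> > m * \<rho> / (real n - 2 - m * real n)"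
    \<comment> \<open>v is C^1 on [0,\<infinity>) with derivative v'\<close>
    and v_deriv: "\<And>r. r \<ge> 0 \<Longrightarrow> (v has_real_derivative v' r) (at r within {0..})"
    and v'_cont: "continuous_on {0..} v'"
    \<comment> \<open>v^m is twice differentiable on (0,\<infinity>), with derivatives w and w'\<close>
    and vm_deriv: "\<And>r. r > 0 \<Longrightarrow> ((\<lambda>s. v s powr m) has_real_derivative w r) (at r)"
    and w_deriv: "\<And>r. r > 0 \<Longrightarrow> (w has_real_derivative w' r) (at r)"
    and ode: "\<And>r. r > 0 \<Longrightarrow>
       (real n - 1) / m * (w' r + (real n - 1) / r * w r) + \<alpha> * v r + \<beta> * r * v' r = 0"
    and v_pos: "\<And>r. r > 0 \<Longrightarrow> v r > 0"
    and v0: "v 0 = \<eta>" and v'0: "v' 0 = 0"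
  shows "((\<lambda>r. r\<^sup>2 * v r powr (1 - m)) \<longlongrightarrow>
           2 * (real n - 1) * (real n * (1 - m) - 2) / ((1 - m) * (\<alpha> * (1 - m) - 2 * \<beta>))) at_top"
proof -
  define k where "k = 1 - m"
  define N where "N = real n - 2"
  define A where "A = \<alpha> / \<beta>"
  define c where "c = \<beta> / (real n - 1)"
  define \<tau> where "\<tau> = A - 2 / k"
  define Q where "Q = 2 * (real n - 1) * (real n * (1 - m) - 2) / ((1 - m) * (\<alpha> * (1 - m) - 2 * \<beta>))"
  define M where "M = real n - 1"
  have M: "M > 0" and N: "real n = N + 2" "N = M - 1" using n by (auto simp: N_def M_def)
  have mn: "real n - 2 - m * real n > 0"
    using m_bound n by (simp add: field_simps)
  have "m * real n < real n" using mn by linarith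
  then have k: "k > 0" using n by (simp add: k_def)
  have b: "\<beta> > 0" using beta mn m_pos rho by (smt (verit) divide_pos_pos mult_pos_pos)
  have rho_eq: "\<alpha> * k - 2 * \<beta> = \<rho>" using alpha k by (simp add: k_def field_simps)
  have c: "c > 0" using b n by (simp add: c_def)
  have tau_eq: "\<tau> = \<rho> / (k * \<beta>)"
    using k b by (simp add: \<tau>_def A_def rho_eq[symmetric] field_simps)
  then have tau: "\<tau> > 0" using k b rho by simp
  have A: "A > 0" using tau k by (simp add: \<tau>_def) (smt (verit) divide_pos_pos)
  \<comment> \<open>With \<open>\<rho> = \<alpha> * k - 2 * \<beta>\<close>, the lower bound on
    \<open>\<beta>\<close> becomes \<open>m * A < N\<close>.\<close>
  have "m * \<rho> < \<beta> * (real n - 2 - m * real n)"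
    using beta mn by (simp add: field_simps)
  then have "m * (\<alpha> * k) < k * (N * \<beta>)"
    unfolding rho_eq[symmetric] by (simp add: k_def N(1) algebra_simps)
  then have "m * \<alpha> < N * \<beta>" using k by (simp add: ac_simps)
  then have D: "A * (N - m * A) > 0" using A b by (simp add: A_def field_simps)
  have Q_eq: "Q = 2 * M * (N * k - 2 * m) / (k * \<rho>)"
    by (simp add: Q_def rho_eq[symmetric] k_def M_def N(1) algebra_simps)
  have Nk: "N * k - 2 * m > 0" using mn by (simp add: k_def N(1) algebra_simps)
  have Q: "Q > 0" using Nk k rho M by (simp add: Q_eq)

  define P where "P s = exp s * v' (exp s) / v (exp s)" for s
  define q where "q s = (exp s)\<^sup>2 * v (exp s) powr k" for s
  have v_at: "(v has_real_derivative v' r) (at r)" if "r > 0" for r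
  proof -
    have "at r within {0..} = at r" using that by (intro at_within_interior) auto
    then show ?thesis using v_deriv[of r] that by simp
  qed
  have w_eq: "w r = m * v r powr m / v r * v' r" if "r > 0" for r
  proof -
    have "((\<lambda>s. v s powr m) has_real_derivative m * v r powr m / v r * v' r) (at r)"
      using v_at[OF that] v_pos[OF that]
      by (auto intro!: derivative_eq_intros simp: powr_diff)
    then show ?thesis using DERIV_unique vm_deriv[OF that] by blast
  qed
  \<comment> \<open>\<open>P\<close> is rewritten through \<open>w\<close>, whose derivative is
    given, whereas none is given for \<open>v'\<close>.\<close>
  have P_eq: "P s = exp s * w (exp s) / (m * v (exp s) powr m)" for s
    using w_eq[of "exp s"] v_pos[of "exp s"] m_pos by (simp add: P_def field_simps)
  have P_deriv: "(P has_real_derivative - P s * (m * P s + N) - c * q s * (A + P s)) (at s)" for s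
  proof -
    define r where "r = exp s"
    define V where "V = v r powr m"
    have r: "r > 0" "v r > 0" "V > 0" using v_pos[of r] by (auto simp: r_def V_def)
    have V: "((\<lambda>x. v (exp x) powr m) has_real_derivative w r * r) (at s)"
      using DERIV_chain2[OF vm_deriv DERIV_exp] by (simp add: r_def)
    have W: "((\<lambda>x. w (exp x)) has_real_derivative w' r * r) (at s)"
      using DERIV_chain2[OF w_deriv DERIV_exp] by (simp add: r_def)
    have P_r: "P s = r * w r / (m * V)" "P s = r * v' r / v r"
      using P_eq[of s] P_def[of s] by (simp_all add: r_def V_def)
    have w_r: "w r = m * V * P s / r" using r m_pos by (simp add: P_r(1))
    have v'_r: "v' r = v r * P s / r" using r by (simp add: P_r(2))
    have q_r: "q s = r\<^sup>2 * v r / V"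
      using r by (simp add: q_def k_def powr_diff V_def flip: r_def)
    have w'_r: "w' r = - M / r * w r - m / M * (\<alpha> * v r + \<beta> * r * v' r)"
    proof -
      have "M / m * (w' r + M / r * w r) + (\<alpha> * v r + \<beta> * r * v' r) = 0"
        using ode[OF r(1)] by (simp only: M_def add.assoc)
      then have "w' r + M / r * w r = - m / M * (\<alpha> * v r + \<beta> * r * v' r)"
        using M m_pos by (simp add: field_simps)
      then show ?thesis by simp
    qed
    have "((\<lambda>s. exp s * w (exp s) / (m * v (exp s) powr m)) has_real_derivative
       ((r * w r + r * (w' r * r)) * (m * V) - r * w r * (m * (w r * r))) / (m * V * (m * V))) (at s)"
      unfolding r_def V_def
      by (rule DERIV_cong[OF DERIV_divide[OF DERIV_mult[OF DERIV_exp W] DERIV_cmult[OF V]]])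
        (use r m_pos in \<open>auto simp: r_def V_def algebra_simps\<close>)
    also have "(\<lambda>s. exp s * w (exp s) / (m * v (exp s) powr m)) = P" using P_eq by auto
    also have "((r * w r + r * (w' r * r)) * (m * V) - r * w r * (m * (w r * r))) / (m * V * (m * V))
       = - P s * (m * P s + N) - c * q s * (A + P s)"
      \<comment> \<open>These substitutions leave a rational identity in \<open>r\<close>,
        \<open>v r\<close>, \<open>V\<close> and \<open>P s\<close>.\<close>
      unfolding w'_r w_r v'_r q_r c_def A_def N(2) M_def[symmetric]
      using r m_pos b M by (simp add: field_simps power2_eq_square)
    finally show ?thesis .
  qed
  have q_deriv: "(q has_real_derivative k * q s * (A + P s - \<tau>)) (at s)" for s
  proof -
    define r where "r = exp s"
    have r: "r > 0" "v r > 0" using v_pos[of r] by (auto simp: r_def)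
    have V: "((\<lambda>x. v (exp x)) has_real_derivative v' r * r) (at s)"
      using DERIV_chain2[OF v_at DERIV_exp] by (simp add: r_def)
    have "(q has_real_derivative 2 * r * r * v r powr k + r\<^sup>2 * (k * v r powr k / v r * (v' r * r))) (at s)"
      unfolding q_def using V r
      by (auto intro!: derivative_eq_intros simp: powr_diff simp flip: r_def)
    \<comment> \<open>The factor is \<open>2 + k * P s\<close>, and
      \<open>\<tau> = A - 2 / k\<close>.\<close>
    also have "2 * r * r * v r powr k + r\<^sup>2 * (k * v r powr k / v r * (v' r * r)) = k * q s * (A + P s - \<tau>)"
      using r k by (simp add: q_def P_def \<tau>_def field_simps power2_eq_square flip: r_def)
    finally show ?thesis .
  qed

  \<comment> \<open>Regularity at the origin makes \<open>r * v' r / v r\<close> vanish there, so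
    \<open>A > 0\<close> provides a starting time \<open>a\<close> with
    \<open>A + P a > 0\<close>.\<close>
  have "((\<lambda>r. A + r * v' r / v r) \<longlongrightarrow> A + 0 * v' 0 / v 0) (at 0 within {0..})"
    using v'_cont v_deriv[of 0, THEN DERIV_continuous] v0 eta
    by (intro tendsto_intros) (auto simp: continuous_on_def continuous_within)
  then have "eventually (\<lambda>r. A + r * v' r / v r > 0) (at 0 within {0..})"
    using A by (intro order_tendstoD(1)) auto
  then obtain d where d: "d > 0" "\<And>r. r \<ge> 0 \<Longrightarrow> r \<noteq> 0 \<Longrightarrow> dist r 0 < d \<Longrightarrow> A + r * v' r / v r > 0"
    unfolding eventually_at by auto
  define a where "a = ln (d / 2)"
  have "A + P a > 0" using d(1) d(2)[of "d / 2"] by (simp add: P_def a_def)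
  have "(q \<longlongrightarrow> Q) at_top"
  \<comment> \<open>\<open>B\<close> and \<open>D\<close> are the coefficients of
    \<open>- P * (m * P + N)\<close> expanded in \<open>t = A + P\<close>.\<close>
  proof (rule planar_system_tendsto[where t = "\<lambda>s. A + P s" and a = a and m = m and c = c
        and k = k and \<tau> = \<tau> and B = "2 * m * A - N" and D = "A * (N - m * A)"])
    show "((\<lambda>s. A + P s) has_real_derivative A * (N - m * A) + (2 * m * A - N) * (A + P s)
        - m * (A + P s)\<^sup>2 - c * q s * (A + P s)) (at s)" for s
      using P_deriv[of s]
      by (auto intro!: derivative_eq_intros simp: algebra_simps power2_eq_square)
    \<comment> \<open>At \<open>t = \<tau>\<close> one has \<open>P = - 2 / k\<close>, which is
      substituted into \<open>- P * (m * P + N)\<close>.\<close>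
    have "A * (N - m * A) + (2 * m * A - N) * \<tau> - m * \<tau>\<^sup>2 = 2 / k * (N - m * (2 / k))"
      by (simp add: \<tau>_def algebra_simps power2_eq_square)
    also have "\<dots> = c * Q * \<tau>"
      using M k rho b by (simp add: c_def Q_eq tau_eq field_simps flip: M_def)
    finally show "A * (N - m * A) + (2 * m * A - N) * \<tau> - m * \<tau>\<^sup>2 = c * Q * \<tau>" .
    show "q s > 0" for s using v_pos[of "exp s"] by (simp add: q_def)
  qed (use q_deriv D m_pos c k tau Q \<open>A + P a > 0\<close> in auto)
  then have "((\<lambda>r. q (ln r)) \<longlongrightarrow> Q) at_top"
    by (rule filterlim_compose[OF _ ln_at_top])
  moreover have "eventually (\<lambda>r. q (ln r) = r\<^sup>2 * v r powr (1 - m)) at_top"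
    using eventually_gt_at_top[of 0] by eventually_elim (simp add: q_def k_def)
  ultimately show ?thesis unfolding Q_def by (simp add: tendsto_cong)
qed

end
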